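(* Let $a\in\mathbb{R}$, let $f,g:\mathbb{N}_a\to\mathbb{R}$, and let $\alpha\in\mathbb{R}\setminus\mathbb{N}^{0}$. Then $$\Delta_a^{-\alpha}[fg](t)=\sum_{n=0}^{t-\alpha-a}\binom{-\alpha}{n}\,\Delta_a^{-(\alpha+n)}f(t)\cdot\Delta^n g(t-\alpha-n),\quad t\in\mathbb{N}_{a+\alpha},$$ where $\Delta^n g(t-\alpha-n)$ denotes the function $\Delta^n g$ evaluated at the point $t-\alpha-n$.
   Context: For a real number $c$, $\mathbb{N}_c=\{c,c+1,c+2,\ldots\}$ and $\mathbb{N}^c=\{\ldots,c-2,c-1,c\}$; in particular $\mathbb{N}^{0}$ is the set of non-positive integers and $\mathbb{N}^{-1}$ the set of negative integers. Forward difference: for $g:\mathbb{N}_a\to\mathbb{R}$, $\Delta g(t)=g(t+1)-g(t)$, $\Delta^0 g=g$, and $\Delta^n g=\Delta(\Delta^{n-1}g)$ for $n\ge1$. Falling function: for $x,y\in\mathbb{R}$, $(x)^{\underline{y}}=x^{\underline{y}}$ equals $x(x-1)\cdots(x-y+1)$ if $y\in\mathbb{N}_1$; $1$ if $y=0$; $\frac{\Gamma(x+1)}{\Gamma(x+1-y)}$ if $x,\,x-y\notin\mathbb{N}^{-1}$; and $0$ if $x\notin\mathbb{N}^{-1}$ and $x-y\in\mathbb{N}^{-1}$. Generalized binomial coefficient: $\binom{x}{n}=\frac{x^{\underline{n}}}{n!}$ for $x\in\mathbb{R}$, $n\in\mathbb{N}_0$. Fractional sum-difference operator (Miller--Ross):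 for $c\in\mathbb{R}$, $\nu\in\mathbb{R}\setminus\mathbb{N}^0$ and $f:\mathbb{N}_c\to\mathbb{R}$, $$\Delta_c^{-\nu}f(t)=\frac{1}{\Gamma(\nu)}\sum_{s=c}^{t-\nu}(t-(s+1))^{\underline{\nu-1}}f(s),\quad t\in\mathbb{N}_{c+\nu},$$ where $s$ runs over $c,c+1,\ldots,t-\nu$. *)

theory Defs
  imports "HOL-Analysis.Gamma_Function"
begin

definition nats_from :: "real \<Rightarrow> real set" where
  "nats_from c = {c + real k |k. True}"

definition nats_upto :: "real \<Rightarrow> real set" where
  "nats_upto c = {c - real k |k. True}"

text \<open>
  A function on \<open>nats_from a\<close> is represented by a total function on the reals; the
  operators below only use its values on \<open>nats_from a\<close>, provided that they are evaluated
  at points of their own domain.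
\<close>

definition fwd_diff :: "(real \<Rightarrow> real) \<Rightarrow> real \<Rightarrow> real" where
  "fwd_diff g t = g (t + 1) - g t"

text \<open>
  The falling function of \<open>x\<close> with real exponent \<open>y\<close>. It is left unspecified when
  \<open>x\<close> is a negative integer and \<open>y\<close> is not a non-negative integer.
\<close>

definition falling :: "real \<Rightarrow> real \<Rightarrow> real" where
  "falling x y =
    (if y \<in> nats_from 1 then (\<Prod>i<nat \<lfloor>y\<rfloor>. x - real i)
     else if y = 0 then 1
     else if x \<notin> nats_upto (-1) \<and> x - y \<notin> nats_upto (-1)
       then Gamma (x + 1) / Gamma (x + 1 - y)
     else if x \<notin> nats_upto (-1) \<and> x - y \<in> nats_upto (-1) then 0
     else undefined)"

text \<open>The library's generalized binomial coefficient is the one given by the falling function.\<close>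

lemma gbinomial_eq_falling: "x gchoose n = falling x (real n) / fact n"
proof (cases n)
  case (Suc m)
  then have "real n \<in> nats_from 1"
    by (auto simp: nats_from_def)
  then show ?thesis
    by (simp add: falling_def gbinomial_prod_rev atLeast0LessThan)
qed (simp add: falling_def nats_from_def)

text \<open>
  \<open>frac_sum c \<nu> f t\<close> is the fractional sum of \<open>f\<close> of order \<open>\<nu>\<close> based at \<open>c\<close>, that is, the
  operator written $\Delta_c^{-\nu}$; it is meant for \<open>\<nu> \<notin> nats_upto 0\<close> and
  \<open>t \<in> nats_from (c + \<nu>)\<close>.
\<close>

definition frac_sum :: "real \<Rightarrow> real \<Rightarrow> (real \<Rightarrow> real) \<Rightarrow> real \<Rightarrow> real" where
  "frac_sum c \<nu> f t =
    1 / Gamma \<nu> * (\<Sum>s | s \<in> nats_from c \<and> s \<le> t - \<nu>. falling (t - (s + 1)) (\<nu> - 1) * f s)"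

end

theory Submission
  imports Defs
begin

text \<open>
  Write \<open>t = a + \<alpha> + N\<close>. The kernel of the fractional sum consists of
  the power series coefficients of \<open>(1 - z) powr (- \<alpha>)\<close>: dividing \<open>falling (\<alpha> + m - 1) (\<alpha> - 1)\<close> by \<open>Gamma \<alpha>\<close>
  gives \<open>pochhammer \<alpha> m / fact m\<close>, whichever branch of the falling function applies
  (lemma \<open>frac_sum_eq_pochhammer_sum\<close>). So both sides of the Leibniz rule are linear
  combinations of the values \<open>f (a + k)\<close> with \<open>k \<le> N\<close>, and it suffices to compare
  coefficients.

  Put \<open>M = N - k\<close>. Since \<open>pochhammer \<alpha> n * pochhammer (\<alpha> + n) (M - n) = pochhammer \<alpha> M\<close>, every
  term contributing to \<open>f (a + k)\<close> on the right contains the factor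
  \<open>pochhammer \<alpha> M / fact M\<close> that stands on the left, and what remains is a binomial sum
  that does not involve \<open>\<alpha>\<close> (lemma \<open>gbinomial_pochhammer_product\<close>). In terms of the backward
  difference \<open>\<nabla>g x = g x - g (x - 1)\<close>, for which \<open>\<nabla>\<^sup>n g x = \<Delta>\<^sup>n g (x - n)\<close>, that sum is
  \<open>(1 - \<nabla>)\<^sup>M g\<close> at \<open>a + N\<close>. As \<open>1 - \<nabla>\<close> is the shift by \<open>-1\<close>, it equals
  \<open>g (a + N - M) = g (a + k)\<close> (lemma \<open>backward_shift_eq_binomial_sum\<close>).
\<close>

section \<open>Fractional sums as sums with binomial-series coefficients\<close>

lemma nats_upto_0_eq_nonpos_Ints: "nats_upto 0 = \<int>\<^sub>\<le>\<^sub>0"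
  by (auto simp: nats_upto_def elim: nonpos_Ints_cases')

text \<open>
  The branches of the falling function for natural and for other exponents agree here: if
  \<open>\<alpha>\<close> is a positive integer, the product is a quotient of factorials, hence of Gamma values.
\<close>

lemma falling_eq_Gamma_quotient:
  assumes "\<alpha> \<notin> \<int>\<^sub>\<le>\<^sub>0"
  shows "falling (\<alpha> + real m - 1) (\<alpha> - 1) = Gamma (\<alpha> + real m) / fact m"
proof (cases "\<exists>j. \<alpha> = real j + 1")
  case True
  then obtain j where j: "\<alpha> = real j + 1" by blast
  have "falling (real (j + m)) (real j) = fact j * (real (j + m) gchoose j)"
    by (simp add: gbinomial_eq_falling)
  also have "real (j + m) gchoose j = fact (j + m) / (fact j * fact m)"
    by (subst binomial_gbinomial [symmetric]) (simp add: binomial_fact)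
  also have "fact j * \<dots> = Gamma (1 + real (j + m)) / fact m"
    by (simp only: Gamma_fact) simp
  finally show ?thesis by (simp add: j add_ac)
next
  case False
  have "\<alpha> - 1 \<notin> nats_from 1"
  proof
    assume "\<alpha> - 1 \<in> nats_from 1"
    then obtain k where "\<alpha> = real (Suc k) + 1" by (auto simp: nats_from_def)
    with False show False by blast
  qed
  moreover have "\<alpha> - 1 \<noteq> 0" using False [simplified, rule_format, of 0] by simp
  moreover have "\<alpha> + real m - 1 \<notin> nats_upto (-1)"
  proof
    assume "\<alpha> + real m - 1 \<in> nats_upto (-1)"
    then obtain k where "\<alpha> + real m - 1 = - 1 - real k" by (auto simp: nats_upto_def)
    then have "\<alpha> = 0 - real (m + k)" by simp
    then have "\<alpha> \<in> nats_upto 0" unfolding nats_upto_def by blast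
    with assms show False by (simp add: nats_upto_0_eq_nonpos_Ints)
  qed
  moreover have "real m \<notin> nats_upto (-1)" by (auto simp: nats_upto_def)
  ultimately show ?thesis
    by (simp add: falling_def Gamma_fact [symmetric] add_ac)
qed

lemma frac_sum_eq_pochhammer_sum:
  assumes "\<alpha> \<notin> \<int>\<^sub>\<le>\<^sub>0"
  shows "frac_sum c \<alpha> f (c + \<alpha> + real N)
    = (\<Sum>k\<le>N. pochhammer \<alpha> (N - k) / fact (N - k) * f (c + real k))"
proof -
  have dom: "{s. s \<in> nats_from c \<and> s \<le> c + \<alpha> + real N - \<alpha>} = (\<lambda>k. c + real k) ` {..N}"
    by (auto simp: nats_from_def)
  have kernel: "falling (c + \<alpha> + real N - (c + real k + 1)) (\<alpha> - 1) / Gamma \<alpha>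
      = pochhammer \<alpha> (N - k) / fact (N - k)" if "k \<le> N" for k
  proof -
    have "c + \<alpha> + real N - (c + real k + 1) = \<alpha> + real (N - k) - 1"
      using that by (simp add: of_nat_diff)
    then show ?thesis
      by (simp only: falling_eq_Gamma_quotient [OF assms] pochhammer_Gamma [OF assms]
          divide_divide_eq_left mult.commute)
  qed
  have "frac_sum c \<alpha> f (c + \<alpha> + real N)
      = (\<Sum>k\<le>N. falling (c + \<alpha> + real N - (c + real k + 1)) (\<alpha> - 1) / Gamma \<alpha> * f (c + real k))"
    unfolding frac_sum_def dom by (simp add: sum.reindex inj_on_def sum_divide_distrib)
  also have "\<dots> = (\<Sum>k\<le>N. pochhammer \<alpha> (N - k) / fact (N - k) * f (c + real k))"
    by (rule sum.cong) (simp_all only: kernel atMost_iff)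
  finally show ?thesis .
qed

section \<open>Comparison of coefficients\<close>

text \<open>
  Splitting off the last factor of \<open>(1 - \<nabla>)\<^sup>M\<^sup>+\<^sup>1\<close> is Pascal's rule; the two parts are
  instances of the formula for \<open>M\<close>, one for \<open>g\<close> at \<open>x\<close> and one for its difference at
  \<open>x - 1\<close>.
\<close>

lemma backward_shift_eq_binomial_sum:
  "(\<Sum>n\<le>M. (-1) ^ n * real (M choose n) * (fwd_diff ^^ n) g (x - real n)) = g (x - real M)"
proof (induction M arbitrary: g x)
  case (Suc M)
  let ?c = "\<lambda>n. (-1) ^ n * (fwd_diff ^^ n) g (x - real n)"
  have "(\<Sum>n\<le>Suc M. (-1) ^ n * real (Suc M choose n) * (fwd_diff ^^ n) g (x - real n))
      = (\<Sum>n\<le>Suc M. real (M choose n) * ?c n) + (\<Sum>n\<le>M. real (M choose n) * ?c (Suc n))"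
    by (subst (1 2) sum.atMost_Suc_shift)
       (simp add: sum.distrib [symmetric] algebra_simps del: funpow.simps)
  also have "(\<Sum>n\<le>Suc M. real (M choose n) * ?c n) = g (x - real M)"
    using Suc.IH [of g x] by (simp add: mult_ac)
  also have "(\<Sum>n\<le>M. real (M choose n) * ?c (Suc n)) = - fwd_diff g (x - 1 - real M)"
    unfolding Suc.IH [of "fwd_diff g" "x - 1", symmetric]
    by (simp add: sum_negf [symmetric] funpow_swap1 algebra_simps)
  finally show ?case
    by (simp add: fwd_diff_def algebra_simps)
qed simp

text \<open>
  This separates \<open>\<alpha>\<close> from the summation index \<open>n\<close>. The sign comes from reflecting
  \<open>(- \<alpha>) gchoose n\<close> into the rising factorial \<open>pochhammer \<alpha> n\<close>, which the second factor
  extends to \<open>pochhammer \<alpha> M\<close>.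
\<close>

lemma gbinomial_pochhammer_product:
  fixes \<alpha> :: real
  assumes "n \<le> M"
  shows "((- \<alpha>) gchoose n) * (pochhammer (\<alpha> + real n) (M - n) / fact (M - n))
    = pochhammer \<alpha> M / fact M * ((-1) ^ n * real (M choose n))"
  using assms
  by (simp add: gbinomial_pochhammer binomial_fact pochhammer_product [of n M \<alpha>])

lemma sum_triangle_swap:
  fixes h :: "nat \<Rightarrow> nat \<Rightarrow> 'b :: comm_monoid_add"
  shows "(\<Sum>n\<le>N. \<Sum>k\<le>N - n. h n k) = (\<Sum>k\<le>N. \<Sum>n\<le>N - k. h n k)"
proof -
  have "(\<Sum>n\<le>N. \<Sum>k\<le>N - n. h n k) = (\<Sum>n\<le>N. \<Sum>k | k \<in> {..N} \<and> n + k \<le> N. h n k)"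
    by (intro sum.cong) auto
  also have "\<dots> = (\<Sum>k\<le>N. \<Sum>n | n \<in> {..N} \<and> n + k \<le> N. h n k)"
    by (rule sum.swap_restrict) auto
  also have "\<dots> = (\<Sum>k\<le>N. \<Sum>n\<le>N - k. h n k)"
    by (intro sum.cong) auto
  finally show ?thesis .
qed

theorem theorem3p10:
  fixes a \<alpha> t :: real and f g :: "real \<Rightarrow> real"
  assumes "\<alpha> \<notin> nats_upto 0"
    and "t \<in> nats_from (a + \<alpha>)"
  shows "frac_sum a \<alpha> (\<lambda>s. f s * g s) t =
    (\<Sum>n | real n \<le> t - \<alpha> - a.
      ((- \<alpha>) gchoose n) * frac_sum a (\<alpha> + real n) f t * (fwd_diff ^^ n) g (t - \<alpha> - real n))"
proof -
  obtain N where t: "t = a + \<alpha> + real N" using assms(2) by (auto simp: nats_from_def)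
  have \<alpha>: "\<alpha> \<notin> \<int>\<^sub>\<le>\<^sub>0" using assms(1) by (simp add: nats_upto_0_eq_nonpos_Ints)
  define p where "p m = pochhammer \<alpha> m / fact m" for m
  define d where "d n = (fwd_diff ^^ n) g (a + real N - real n)" for n
  have shifted: "frac_sum a (\<alpha> + real n) f t = (\<Sum>k\<le>N - n.
      pochhammer (\<alpha> + real n) (N - k - n) / fact (N - k - n) * f (a + real k))"
    if "n \<le> N" for n
  proof -
    have regular: "\<alpha> + real n \<notin> \<int>\<^sub>\<le>\<^sub>0"
      using \<alpha> nonpos_Ints_diff_Nats [of "\<alpha> + real n" "real n"] by auto
    have "t = a + (\<alpha> + real n) + real (N - n)"
      using that by (simp add: t of_nat_diff)
    then show ?thesis
      by (simp only: frac_sum_eq_pochhammer_sum [OF regular] diff_commute [of N _ n])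
  qed
  have "(\<Sum>n | real n \<le> t - \<alpha> - a.
      ((- \<alpha>) gchoose n) * frac_sum a (\<alpha> + real n) f t * (fwd_diff ^^ n) g (t - \<alpha> - real n))
    = (\<Sum>n\<le>N. \<Sum>k\<le>N - n. f (a + real k) * p (N - k) * ((-1) ^ n * real (N - k choose n) * d n))"
  proof (rule sum.cong)
    fix n assume "n \<in> {..N}"
    then have n: "n \<le> N" by simp
    have "((- \<alpha>) gchoose n) * frac_sum a (\<alpha> + real n) f t * (fwd_diff ^^ n) g (t - \<alpha> - real n)
      = (\<Sum>k\<le>N - n. f (a + real k) * (((- \<alpha>) gchoose n)
          * (pochhammer (\<alpha> + real n) (N - k - n) / fact (N - k - n))) * d n)"
      unfolding shifted [OF n] by (simp add: t d_def sum_distrib_left sum_distrib_right mult_ac)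
    also have "\<dots> = (\<Sum>k\<le>N - n. f (a + real k) * p (N - k) * ((-1) ^ n * real (N - k choose n) * d n))"
    proof (rule sum.cong)
      fix k assume "k \<in> {..N - n}"
      then have "n \<le> N - k" using n by auto
      then show "f (a + real k) * (((- \<alpha>) gchoose n)
          * (pochhammer (\<alpha> + real n) (N - k - n) / fact (N - k - n))) * d n
        = f (a + real k) * p (N - k) * ((-1) ^ n * real (N - k choose n) * d n)"
        by (subst gbinomial_pochhammer_product) (simp_all add: p_def)
    qed simp
    finally show "((- \<alpha>) gchoose n) * frac_sum a (\<alpha> + real n) f t
        * (fwd_diff ^^ n) g (t - \<alpha> - real n)
      = (\<Sum>k\<le>N - n. f (a + real k) * p (N - k) * ((-1) ^ n * real (N - k choose n) * d n))" .
  qed (auto simp: t)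
  also have "\<dots> = (\<Sum>k\<le>N. \<Sum>n\<le>N - k. f (a + real k) * p (N - k) * ((-1) ^ n * real (N - k choose n) * d n))"
    by (rule sum_triangle_swap)
  also have "\<dots> = (\<Sum>k\<le>N. p (N - k) * (f (a + real k) * g (a + real k)))"
  proof (rule sum.cong)
    fix k assume "k \<in> {..N}"
    then have "(\<Sum>n\<le>N - k. (-1) ^ n * real (N - k choose n) * d n) = g (a + real k)"
      unfolding d_def by (subst backward_shift_eq_binomial_sum) (simp add: of_nat_diff)
    then show "(\<Sum>n\<le>N - k. f (a + real k) * p (N - k) * ((-1) ^ n * real (N - k choose n) * d n))
      = p (N - k) * (f (a + real k) * g (a + real k))"
      by (simp add: sum_distrib_left [symmetric])
  qed simp
  also have "\<dots> = frac_sum a \<alpha> (\<lambda>s. f s * g s) t"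
    unfolding t p_def using \<alpha> by (simp add: frac_sum_eq_pochhammer_sum)
  finally show ?thesis by simp
qed

end
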